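(* There is a map of monads $\tau:\mathcal{UF}\Rightarrow\mathcal{E}$ from the ultrafilter monad to the expectation monad, given for a set $X$, an ultrafilter $\mathcal{F}\in\mathcal{UF}(X)$ and $p\in[0,1]^X$ by $$\tau_X(\mathcal{F})(p)=\mathrm{ch}\big(\mathcal{UF}(p)(\mathcal{F})\big)=\inf\{s\in[0,1]\mid\{x\in X\mid p(x)\le s\}\in\mathcal{F}\}.$$
   Context: Effect algebra: a set $E$ with a partial commutative associative operation $\oplus$ with neutral element $0$ and a map $(-)^\perp$ such that, with $1:=0^\perp$, $x^\perp$ is the unique element with $x\oplus x^\perp=1$, and $x\oplus 1$ is defined only if $x=0$. Effect module: an effect algebra with scalar multiplication $[0,1]\times E\to E$ with $1x=x$, $(rs)x=r(sx)$, $(r+s)x=rx\oplus sx$ if $r+s\le1$, and $r(x\oplus y)=rx\oplus ry$ if $x\oplus y$ is defined. Category $\mathbf{EMod}$: maps preserve $1$, defined sums $\oplus$, and scalar multiplication. $[0,1]^X$ is an effect module pointwise ($p\oplus q=p+q$ defined iff $p+q\le1$ pointwise). Expectation monad on $\mathbf{Sets}$: $\mathcal{E}(X)=\mathbf{EMod}([0,1]^X,[0,1])$, $\mathcal{E}(f)(h)(p)=h(p\circ f)$, unit $\eta(x)(p)=p(x)$, multiplication $\mu(h)(p)=h(\lambda k\in\mathcal{E}(X).\,k(p))$. Ultrafilter monad on $\mathbf{Sets}$: $\mathcal{UF}(X)$ is the set of ultrafilters on $X$, $\mathcal{UF}(f)(\mathcal{F})=\{V\mid f^{-1}(V)\in\mathcal{F}\}$,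 $\eta(x)=\{U\subseteq X\mid x\in U\}$, $\mu(\mathcal{A})=\{U\subseteq X\mid\{\mathcal{F}\in\mathcal{UF}(X)\mid U\in\mathcal{F}\}\in\mathcal{A}\}$. The map $\mathrm{ch}:\mathcal{UF}([0,1])\to[0,1]$ sends an ultrafilter on the compact Hausdorff space $[0,1]$ to its limit; $\mathrm{ch}(\mathcal{F})=\inf\{s\mid[0,s]\in\mathcal{F}\}$. A map of monads is a natural transformation commuting with units and multiplications. *)

theory Defs
  imports "HOL-Analysis.Analysis"
begin

section \<open>Effect algebras and effect modules\<close>

text \<open>The sum is partial: \<open>None\<close> means that it is undefined.\<close>

record 'a effect_alg =
  carrier :: "'a set"
  osum :: "'a \<Rightarrow> 'a \<Rightarrow> 'a option"
  ozero :: 'a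
  orth :: "'a \<Rightarrow> 'a"

record 'a effect_mod = "'a effect_alg" +
  smul :: "real \<Rightarrow> 'a \<Rightarrow> 'a"

definition oone :: "('a, 'm) effect_alg_scheme \<Rightarrow> 'a" where
  "oone E = orth E (ozero E)"

locale effect_algebra =
  fixes E :: "('a, 'm) effect_alg_scheme" (structure)
  assumes osum_closed:
      "\<lbrakk>x \<in> carrier E; y \<in> carrier E; osum E x y = Some z\<rbrakk> \<Longrightarrow> z \<in> carrier E"
    and zero_closed: "ozero E \<in> carrier E"
    and orth_closed: "x \<in> carrier E \<Longrightarrow> orth E x \<in> carrier E"
    and osum_commute:
      "\<lbrakk>x \<in> carrier E; y \<in> carrier E\<rbrakk> \<Longrightarrow> osum E x y = osum E y x"
    and osum_assoc:
      "\<lbrakk>x \<in> carrier E; y \<in> carrier E; z \<in> carrier E\<rbrakk> \<Longrightarrow>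
        Option.bind (osum E x y) (\<lambda>u. osum E u z) = Option.bind (osum E y z) (\<lambda>v. osum E x v)"
    and osum_zero: "x \<in> carrier E \<Longrightarrow> osum E x (ozero E) = Some x"
    and osum_orth:
      "\<lbrakk>x \<in> carrier E; y \<in> carrier E\<rbrakk> \<Longrightarrow> osum E x y = Some (oone E) \<longleftrightarrow> y = orth E x"
    and osum_one: "\<lbrakk>x \<in> carrier E; osum E x (oone E) \<noteq> None\<rbrakk> \<Longrightarrow> x = ozero E"

locale effect_module = effect_algebra E for E :: "('a, 'm) effect_mod_scheme" (structure) +
  assumes smul_closed:
      "\<lbrakk>r \<in> {0..1}; x \<in> carrier E\<rbrakk> \<Longrightarrow> smul E r x \<in> carrier E"
    and smul_one: "x \<in> carrier E \<Longrightarrow> smul E 1 x = x"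
    and smul_smul:
      "\<lbrakk>r \<in> {0..1}; s \<in> {0..1}; x \<in> carrier E\<rbrakk> \<Longrightarrow> smul E (r * s) x = smul E r (smul E s x)"
    and smul_add:
      "\<lbrakk>r \<in> {0..1}; s \<in> {0..1}; r + s \<le> 1; x \<in> carrier E\<rbrakk> \<Longrightarrow>
        osum E (smul E r x) (smul E s x) = Some (smul E (r + s) x)"
    and smul_osum:
      "\<lbrakk>r \<in> {0..1}; x \<in> carrier E; y \<in> carrier E; osum E x y = Some z\<rbrakk> \<Longrightarrow>
        osum E (smul E r x) (smul E r y) = Some (smul E r z)"

text \<open>Morphisms are extensional functions, so that equality of morphisms is equality in HOL.\<close>

definition EMod :: "('a, 'm) effect_mod_scheme \<Rightarrow> ('b, 'n) effect_mod_scheme \<Rightarrow> ('a \<Rightarrow> 'b) set" where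
  "EMod A B = {h \<in> carrier A \<rightarrow>\<^sub>E carrier B.
     h (oone A) = oone B \<and>
     (\<forall>x\<in>carrier A. \<forall>y\<in>carrier A. \<forall>z. osum A x y = Some z \<longrightarrow> osum B (h x) (h y) = Some (h z)) \<and>
     (\<forall>r\<in>{0..1}. \<forall>x\<in>carrier A. h (smul A r x) = smul B r (h x))}"

definition unit_interval :: "real effect_mod" where
  "unit_interval = \<lparr>carrier = {0..1},
     osum = (\<lambda>r s. if r + s \<le> 1 then Some (r + s) else None),
     ozero = 0,
     orth = (\<lambda>r. 1 - r),
     smul = (*)\<rparr>"

definition unit_power :: "'a set \<Rightarrow> ('a \<Rightarrow> real) effect_mod" where
  "unit_power X = \<lparr>carrier = X \<rightarrow>\<^sub>E {0..1},
     osum = (\<lambda>p q. if \<forall>x\<in>X. p x + q x \<le> 1 then Some (\<lambda>x\<in>X. p x + q x) else None),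
     ozero = (\<lambda>x\<in>X. 0),
     orth = (\<lambda>p. \<lambda>x\<in>X. 1 - p x),
     smul = (\<lambda>r p. \<lambda>x\<in>X. r * p x)\<rparr>"

lemma unit_mult_add_le_one:
  fixes r s x :: real
  shows "\<lbrakk>0 \<le> r; 0 \<le> s; r + s \<le> 1; 0 \<le> x; x \<le> 1\<rbrakk> \<Longrightarrow> r * x + s * x \<le> 1"
  using mult_le_one[of "r + s" x] by (simp add: distrib_right)

lemma unit_mult_add_le_one2:
  fixes r x y :: real
  shows "\<lbrakk>x + y \<le> 1; 0 \<le> r; r \<le> 1; 0 \<le> x; 0 \<le> y\<rbrakk> \<Longrightarrow> r * x + r * y \<le> 1"
  using mult_le_one[of r "x + y"] by (simp add: distrib_left)

lemma effect_module_unit_interval: "effect_module unit_interval"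
  by unfold_locales
    (auto simp: unit_interval_def oone_def algebra_simps mult_le_one unit_mult_add_le_one unit_mult_add_le_one2
      split: if_splits bind_splits)

lemma effect_module_unit_power: "effect_module (unit_power X)"
proof -
  have b: "0 \<le> p x" "p x \<le> 1" if "p \<in> X \<rightarrow>\<^sub>E {0..1}" "x \<in> X" for p :: "'a \<Rightarrow> real" and x
    using PiE_mem[OF that] by auto
  show ?thesis
  proof (unfold_locales, goal_cases)
    case (5 p q r)
    then have n: "0 \<le> p x" "0 \<le> q x" "0 \<le> r x" if "x \<in> X" for x
      using b that by (auto simp: unit_power_def)
    have e: "(\<forall>x\<in>X. p x + q x \<le> 1) \<and> (\<forall>x\<in>X. p x + q x + r x \<le> 1) \<longleftrightarrow>
      (\<forall>x\<in>X. q x + r x \<le> 1) \<and> (\<forall>x\<in>X. p x + (q x + r x) \<le> 1)"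
      using n by (force simp: add.assoc)
    show ?case using e by (auto simp: unit_power_def add.assoc cong: restrict_cong)
  next
    case (7 p q)
    then have p: "p \<in> X \<rightarrow>\<^sub>E {0..1}" and q: "q \<in> X \<rightarrow>\<^sub>E {0..1}" by (simp_all add: unit_power_def)
    have q': "q = (\<lambda>x\<in>X. 1 - p x) \<longleftrightarrow> (\<forall>x\<in>X. q x = 1 - p x)"
      using PiE_arb[OF q] by (auto simp: fun_eq_iff)
    have "(\<lambda>x\<in>X. p x + q x) = (\<lambda>x\<in>X. 1) \<longleftrightarrow> (\<forall>x\<in>X. p x + q x = 1)"
      by (auto simp: fun_eq_iff)
    moreover have "(\<forall>x\<in>X. p x + q x = 1) \<longleftrightarrow> (\<forall>x\<in>X. q x = 1 - p x)"
      by (intro ball_cong) auto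
    ultimately show ?case
      by (auto simp: unit_power_def oone_def q' cong: restrict_cong)
  next
    case (8 p)
    then have p: "p \<in> X \<rightarrow>\<^sub>E {0..1}" by (simp add: unit_power_def)
    have "\<forall>x\<in>X. p x \<le> 0"
      using 8(2) by (simp add: unit_power_def oone_def split: if_splits)
    then have "p = (\<lambda>x\<in>X. 0)"
      using b[OF p] PiE_arb[OF p] by (auto simp: fun_eq_iff intro: order_antisym)
    then show ?case by (simp add: unit_power_def)
  next
    case 1
    then show ?case by (auto simp: unit_power_def restrict_PiE_iff b split: if_splits)
  next
    case 2
    then show ?case by (simp add: unit_power_def)
  next
    case (3 p)
    then show ?case by (simp add: unit_power_def restrict_PiE_iff b)
  next
    case (4 p q)
    then show ?case by (simp add: unit_power_def add.commute)
  next
    case (6 p)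
    then have p: "p \<in> X \<rightarrow>\<^sub>E {0..1}" by (simp add: unit_power_def)
    then have "(\<lambda>x\<in>X. p x) = p" by (simp add: PiE_restrict)
    then show ?case using b[OF p] by (simp add: unit_power_def cong: restrict_cong)
  next
    case (9 r p)
    then show ?case by (simp add: unit_power_def restrict_PiE_iff b mult_le_one)
  next
    case (10 p)
    then have p: "p \<in> X \<rightarrow>\<^sub>E {0..1}" by (simp add: unit_power_def)
    then have "(\<lambda>x\<in>X. p x) = p" by (simp add: PiE_restrict)
    then show ?case by (simp add: unit_power_def)
  next
    case (11 r s p)
    then show ?case by (simp add: unit_power_def mult.assoc cong: restrict_cong)
  next
    case (12 r s p)
    then show ?case
      by (simp add: unit_power_def b unit_mult_add_le_one distrib_right cong: restrict_cong)
  next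
    case (13 r p q s)
    then show ?case
      by (auto simp: unit_power_def b unit_mult_add_le_one2 distrib_left
        split: if_splits cong: restrict_cong)
  qed
qed

lemma unit_interval_simps [simp]:
  "carrier unit_interval = {0..1}" "oone unit_interval = 1" "smul unit_interval r x = r * x"
  "osum unit_interval a b = (if a + b \<le> 1 then Some (a + b) else None)"
  by (simp_all add: unit_interval_def oone_def)

lemma unit_power_simps [simp]:
  "carrier (unit_power X) = X \<rightarrow>\<^sub>E {0..1}" "oone (unit_power X) = (\<lambda>x\<in>X. 1)"
  "smul (unit_power X) r p = (\<lambda>x\<in>X. r * p x)"
  "osum (unit_power X) p q = (if \<forall>x\<in>X. p x + q x \<le> 1 then Some (\<lambda>x\<in>X. p x + q x) else None)"
  by (auto simp: unit_power_def oone_def)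


section \<open>The expectation monad\<close>

definition EM :: "'a set \<Rightarrow> (('a \<Rightarrow> real) \<Rightarrow> real) set" where
  "EM X = EMod (unit_power X) unit_interval"

definition EM_map ::
    "'a set \<Rightarrow> 'b set \<Rightarrow> ('a \<Rightarrow> 'b) \<Rightarrow> (('a \<Rightarrow> real) \<Rightarrow> real) \<Rightarrow> (('b \<Rightarrow> real) \<Rightarrow> real)" where
  "EM_map X Y f h = (\<lambda>p \<in> Y \<rightarrow>\<^sub>E {0..1}. h (compose X p f))"

definition EM_unit :: "'a set \<Rightarrow> 'a \<Rightarrow> (('a \<Rightarrow> real) \<Rightarrow> real)" where
  "EM_unit X x = (\<lambda>p \<in> X \<rightarrow>\<^sub>E {0..1}. p x)"

definition EM_mult ::
    "'a set \<Rightarrow> (((('a \<Rightarrow> real) \<Rightarrow> real) \<Rightarrow> real) \<Rightarrow> real) \<Rightarrow> (('a \<Rightarrow> real) \<Rightarrow> real)" where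
  "EM_mult X h = (\<lambda>p \<in> X \<rightarrow>\<^sub>E {0..1}. h (\<lambda>k \<in> EM X. k p))"


lemma EM_D:
  assumes "h \<in> EM X"
  shows "h \<in> (X \<rightarrow>\<^sub>E {0..1}) \<rightarrow>\<^sub>E {0..1}"
    and "h (\<lambda>x\<in>X. 1) = 1"
    and "\<forall>p\<in>X \<rightarrow>\<^sub>E {0..1}. \<forall>q\<in>X \<rightarrow>\<^sub>E {0..1}. \<forall>z. osum (unit_power X) p q = Some z \<longrightarrow>
      osum unit_interval (h p) (h q) = Some (h z)"
    and "\<forall>r\<in>{0..1}. \<forall>p\<in>X \<rightarrow>\<^sub>E {0..1}. h (\<lambda>x\<in>X. r * p x) = r * h p"
proof -
  note D = assms[unfolded EM_def EMod_def mem_Collect_eq unit_power_simps(1-3) unit_interval_simps(1-3)]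
  note D2 = conjunct2[OF D]
  note D3 = conjunct2[OF D2]
  show "h \<in> (X \<rightarrow>\<^sub>E {0..1}) \<rightarrow>\<^sub>E {0..1}" by (rule conjunct1[OF D])
  show "h (\<lambda>x\<in>X. 1) = 1" by (rule conjunct1[OF D2])
  show "\<forall>p\<in>X \<rightarrow>\<^sub>E {0..1}. \<forall>q\<in>X \<rightarrow>\<^sub>E {0..1}. \<forall>z. osum (unit_power X) p q = Some z \<longrightarrow>
      osum unit_interval (h p) (h q) = Some (h z)"
    by (rule conjunct1[OF D3])
  show "\<forall>r\<in>{0..1}. \<forall>p\<in>X \<rightarrow>\<^sub>E {0..1}. h (\<lambda>x\<in>X. r * p x) = r * h p"
    by (rule conjunct2[OF D3])
qed

lemmas EM_mem = PiE_mem[OF EM_D(1)]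

lemmas EM_one = EM_D(2)

lemma EM_add:
  assumes h: "h \<in> EM X" and p: "p \<in> X \<rightarrow>\<^sub>E {0..1}" and q: "q \<in> X \<rightarrow>\<^sub>E {0..1}"
    and le: "\<forall>x\<in>X. p x + q x \<le> 1"
  shows "h p + h q \<le> 1" "h (\<lambda>x\<in>X. p x + q x) = h p + h q"
proof -
  have "osum (unit_power X) p q = Some (\<lambda>x\<in>X. p x + q x)"
    using le unfolding unit_power_simps by (rule if_P)
  then have "osum unit_interval (h p) (h q) = Some (h (\<lambda>x\<in>X. p x + q x))"
    by (rule EM_D(3)[OF h, THEN bspec, OF p, THEN bspec, OF q, THEN spec, THEN mp])
  then show "h p + h q \<le> 1" "h (\<lambda>x\<in>X. p x + q x) = h p + h q"
    by (simp_all split: if_splits)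
qed

lemma EM_scale:
  assumes h: "h \<in> EM X" and r: "r \<in> {0..1}" and p: "p \<in> X \<rightarrow>\<^sub>E {0..1}"
  shows "h (\<lambda>x\<in>X. r * p x) = r * h p"
  by (rule EM_D(4)[OF h, THEN bspec, OF r, THEN bspec, OF p])

lemma EM_I:
  assumes "h \<in> extensional (X \<rightarrow>\<^sub>E {0..1})"
    and "\<And>p. p \<in> X \<rightarrow>\<^sub>E {0..1} \<Longrightarrow> h p \<in> {0..1}"
    and "h (\<lambda>x\<in>X. 1) = 1"
    and "\<And>p q. \<lbrakk>p \<in> X \<rightarrow>\<^sub>E {0..1}; q \<in> X \<rightarrow>\<^sub>E {0..1}; \<forall>x\<in>X. p x + q x \<le> 1\<rbrakk>
           \<Longrightarrow> h p + h q \<le> 1 \<and> h (\<lambda>x\<in>X. p x + q x) = h p + h q"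
    and "\<And>r p. \<lbrakk>r \<in> {0..1}; p \<in> X \<rightarrow>\<^sub>E {0..1}\<rbrakk> \<Longrightarrow> h (\<lambda>x\<in>X. r * p x) = r * h p"
  shows "h \<in> EM X"
  unfolding EM_def EMod_def unit_power_simps(1-3) unit_interval_simps(1-3) mem_Collect_eq
proof (intro conjI ballI allI impI)
  show "h \<in> (X \<rightarrow>\<^sub>E {0..1}) \<rightarrow>\<^sub>E {0..1}" by (rule PiE_I) (use assms(1,2) in \<open>auto simp only: extensional_def mem_Collect_eq\<close>)
  fix p q z
  assume a: "p \<in> X \<rightarrow>\<^sub>E {0..1}" "q \<in> X \<rightarrow>\<^sub>E {0..1}" "osum (unit_power X) p q = Some z"
  from a(3) have z: "\<forall>x\<in>X. p x + q x \<le> 1" "z = (\<lambda>x\<in>X. p x + q x)"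
    by (simp_all split: if_splits)
  show "osum unit_interval (h p) (h q) = Some (h z)"
    using assms(4)[OF a(1,2) z(1)] by (simp add: z(2))
qed (fact assms)+

lemma EM_ext:
  assumes h: "h \<in> EM X" and k: "k \<in> EM X" and eq: "\<And>p. p \<in> X \<rightarrow>\<^sub>E {0..1} \<Longrightarrow> h p = k p"
  shows "h = k"
  by (rule PiE_ext[OF EM_D(1)[OF h] EM_D(1)[OF k]]) (rule eq)

lemma compose_mem: "f \<in> X \<rightarrow> Y \<Longrightarrow> p \<in> Y \<rightarrow>\<^sub>E A \<Longrightarrow> compose X p f \<in> X \<rightarrow>\<^sub>E A"
  unfolding compose_def restrict_PiE_iff by (intro ballI) (rule PiE_mem, assumption, rule funcset_mem)

lemma eval_mem: "p \<in> X \<rightarrow>\<^sub>E {0..1} \<Longrightarrow> (\<lambda>k\<in>EM X. k p) \<in> EM X \<rightarrow>\<^sub>E {0..1}"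
  unfolding restrict_PiE_iff by (intro ballI EM_mem)

lemma unit_power_mem:
  fixes p q :: "'a \<Rightarrow> real"
  shows "(\<lambda>x\<in>X. 1) \<in> X \<rightarrow>\<^sub>E {0..1::real}"
    and "\<lbrakk>p \<in> X \<rightarrow>\<^sub>E {0..1}; q \<in> X \<rightarrow>\<^sub>E {0..1}; \<forall>x\<in>X. p x + q x \<le> 1\<rbrakk>
      \<Longrightarrow> (\<lambda>x\<in>X. p x + q x) \<in> X \<rightarrow>\<^sub>E {0..1}"
    and "\<lbrakk>r \<in> {0..1}; p \<in> X \<rightarrow>\<^sub>E {0..1}\<rbrakk> \<Longrightarrow> (\<lambda>x\<in>X. r * p x) \<in> X \<rightarrow>\<^sub>E {0..1}"
proof -
  have b: "0 \<le> p x" "p x \<le> 1" if "p \<in> X \<rightarrow>\<^sub>E {0..1}" "x \<in> X" for p :: "'a \<Rightarrow> real" and x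
    using PiE_mem[OF that] by auto
  show "(\<lambda>x\<in>X. 1) \<in> X \<rightarrow>\<^sub>E {0..1::real}" by (simp add: restrict_PiE_iff)
  show "(\<lambda>x\<in>X. p x + q x) \<in> X \<rightarrow>\<^sub>E {0..1}"
    if "p \<in> X \<rightarrow>\<^sub>E {0..1}" "q \<in> X \<rightarrow>\<^sub>E {0..1}" "\<forall>x\<in>X. p x + q x \<le> 1"
    using that b[OF that(1)] b[OF that(2)] by (simp add: restrict_PiE_iff)
  show "(\<lambda>x\<in>X. r * p x) \<in> X \<rightarrow>\<^sub>E {0..1}" if "r \<in> {0..1}" "p \<in> X \<rightarrow>\<^sub>E {0..1}"
    using that(1) b[OF that(2)] by (simp add: restrict_PiE_iff mult_le_one)
qed

text \<open>
  A map into the carrier of \<open>[0,1]\<^sup>X\<close> that preserves the structure pulls back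
  morphisms to \<open>[0,1]\<close>.
\<close>

lemma EM_pullback:
  assumes h: "h \<in> EM X"
    and c: "\<And>p. p \<in> Y \<rightarrow>\<^sub>E {0..1} \<Longrightarrow> \<phi> p \<in> X \<rightarrow>\<^sub>E {0..1}"
    and one: "\<phi> (\<lambda>y\<in>Y. 1) = (\<lambda>x\<in>X. 1)"
    and add: "\<And>p q. \<lbrakk>p \<in> Y \<rightarrow>\<^sub>E {0..1}; q \<in> Y \<rightarrow>\<^sub>E {0..1}; \<forall>y\<in>Y. p y + q y \<le> 1\<rbrakk> \<Longrightarrow>
        (\<forall>x\<in>X. \<phi> p x + \<phi> q x \<le> 1) \<and> \<phi> (\<lambda>y\<in>Y. p y + q y) = (\<lambda>x\<in>X. \<phi> p x + \<phi> q x)"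
    and scale: "\<And>r p. \<lbrakk>r \<in> {0..1}; p \<in> Y \<rightarrow>\<^sub>E {0..1}\<rbrakk> \<Longrightarrow>
        \<phi> (\<lambda>y\<in>Y. r * p y) = (\<lambda>x\<in>X. r * \<phi> p x)"
  shows "(\<lambda>p \<in> Y \<rightarrow>\<^sub>E {0..1}. h (\<phi> p)) \<in> EM Y"
proof (rule EM_I)
  show "(\<lambda>p \<in> Y \<rightarrow>\<^sub>E {0..1}. h (\<phi> p)) \<in> extensional (Y \<rightarrow>\<^sub>E {0..1})" by (rule restrict_extensional)
  show "(\<lambda>p \<in> Y \<rightarrow>\<^sub>E {0..1}. h (\<phi> p)) (\<lambda>y\<in>Y. 1) = 1"
    unfolding restrict_apply'[OF unit_power_mem(1)] one by (rule EM_one[OF h])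
next
  fix p assume p: "p \<in> Y \<rightarrow>\<^sub>E {0..1::real}"
  show "(\<lambda>p \<in> Y \<rightarrow>\<^sub>E {0..1}. h (\<phi> p)) p \<in> {0..1}"
    unfolding restrict_apply'[OF p] by (rule EM_mem[OF h c[OF p]])
  fix r :: real assume r: "r \<in> {0..1}"
  show "(\<lambda>p \<in> Y \<rightarrow>\<^sub>E {0..1}. h (\<phi> p)) (\<lambda>y\<in>Y. r * p y) = r * (\<lambda>p \<in> Y \<rightarrow>\<^sub>E {0..1}. h (\<phi> p)) p"
    unfolding restrict_apply'[OF p] restrict_apply'[OF unit_power_mem(3)[OF r p]] scale[OF r p]
    by (rule EM_scale[OF h r c[OF p]])
next
  fix p q
  assume p: "p \<in> Y \<rightarrow>\<^sub>E {0..1::real}" and q: "q \<in> Y \<rightarrow>\<^sub>E {0..1::real}" and s: "\<forall>y\<in>Y. p y + q y \<le> 1"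
  note a = add[OF p q s]
  show "(\<lambda>p \<in> Y \<rightarrow>\<^sub>E {0..1}. h (\<phi> p)) p + (\<lambda>p \<in> Y \<rightarrow>\<^sub>E {0..1}. h (\<phi> p)) q \<le> 1 \<and>
    (\<lambda>p \<in> Y \<rightarrow>\<^sub>E {0..1}. h (\<phi> p)) (\<lambda>y\<in>Y. p y + q y) =
    (\<lambda>p \<in> Y \<rightarrow>\<^sub>E {0..1}. h (\<phi> p)) p + (\<lambda>p \<in> Y \<rightarrow>\<^sub>E {0..1}. h (\<phi> p)) q"
    unfolding restrict_apply'[OF p] restrict_apply'[OF q]
      restrict_apply'[OF unit_power_mem(2)[OF p q s]] conjunct2[OF a]
    using EM_add[OF h c[OF p] c[OF q] conjunct1[OF a]] by blast
qed

lemma EM_map_closed: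
  assumes f: "f \<in> X \<rightarrow> Y" and h: "h \<in> EM X"
  shows "EM_map X Y f h \<in> EM Y"
  unfolding EM_map_def
proof (rule EM_pullback[OF h])
  have fx: "f x \<in> Y" if "x \<in> X" for x using f that by (rule funcset_mem)
  show "compose X p f \<in> X \<rightarrow>\<^sub>E {0..1}" if "p \<in> Y \<rightarrow>\<^sub>E {0..1}" for p :: "'b \<Rightarrow> real"
    using f that by (rule compose_mem)
  show "compose X (\<lambda>y\<in>Y. 1::real) f = (\<lambda>x\<in>X. 1)"
    unfolding compose_def by (rule restrict_ext) (simp add: fx)
  show "(\<forall>x\<in>X. compose X p f x + compose X q f x \<le> 1) \<and>
      compose X (\<lambda>y\<in>Y. p y + q y) f = (\<lambda>x\<in>X. compose X p f x + compose X q f x)"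
    if "\<forall>y\<in>Y. p y + q y \<le> 1" for p q :: "'b \<Rightarrow> real"
    using that by (simp add: compose_def fx cong: restrict_cong)
  show "compose X (\<lambda>y\<in>Y. r * p y) f = (\<lambda>x\<in>X. r * compose X p f x)" for r and p :: "'b \<Rightarrow> real"
    by (simp add: compose_def fx cong: restrict_cong)
qed

lemma EM_unit_closed:
  assumes x: "x \<in> X"
  shows "EM_unit X x \<in> EM X"
proof (rule EM_I)
  show "EM_unit X x \<in> extensional (X \<rightarrow>\<^sub>E {0..1})" by (simp add: EM_unit_def)
  show "EM_unit X x p \<in> {0..1}" if "p \<in> X \<rightarrow>\<^sub>E {0..1}" for p
    unfolding EM_unit_def restrict_apply'[OF that] using that x by (rule PiE_mem)
  show "EM_unit X x (\<lambda>x\<in>X. 1) = 1"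
    unfolding EM_unit_def restrict_apply'[OF unit_power_mem(1)] using x by simp
  show "EM_unit X x p + EM_unit X x q \<le> 1 \<and>
      EM_unit X x (\<lambda>x\<in>X. p x + q x) = EM_unit X x p + EM_unit X x q"
    if "p \<in> X \<rightarrow>\<^sub>E {0..1}" "q \<in> X \<rightarrow>\<^sub>E {0..1}" "\<forall>x\<in>X. p x + q x \<le> 1" for p q
    unfolding EM_unit_def restrict_apply'[OF that(1)] restrict_apply'[OF that(2)]
      restrict_apply'[OF unit_power_mem(2)[OF that]] using x that(3) by simp
  show "EM_unit X x (\<lambda>x\<in>X. r * p x) = r * EM_unit X x p"
    if "r \<in> {0..1}" "p \<in> X \<rightarrow>\<^sub>E {0..1}" for r p
    unfolding EM_unit_def restrict_apply'[OF that(2)]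
      restrict_apply'[OF unit_power_mem(3)[OF that]] using x by simp
qed

lemma EM_mult_closed:
  assumes h: "h \<in> EM (EM X)"
  shows "EM_mult X h \<in> EM X"
  unfolding EM_mult_def
proof (rule EM_pullback[OF h])
  show "(\<lambda>k\<in>EM X. k p) \<in> EM X \<rightarrow>\<^sub>E {0..1}" if "p \<in> X \<rightarrow>\<^sub>E {0..1}" for p
    using that by (rule eval_mem)
  show "(\<lambda>k\<in>EM X. k (\<lambda>x\<in>X. 1)) = (\<lambda>k\<in>EM X. 1)"
    by (rule restrict_ext) (rule EM_one)
  show "(\<forall>k\<in>EM X. (\<lambda>k\<in>EM X. k p) k + (\<lambda>k\<in>EM X. k q) k \<le> 1) \<and>
      (\<lambda>k\<in>EM X. k (\<lambda>x\<in>X. p x + q x)) = (\<lambda>k\<in>EM X. (\<lambda>k\<in>EM X. k p) k + (\<lambda>k\<in>EM X. k q) k)"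
    if "p \<in> X \<rightarrow>\<^sub>E {0..1}" "q \<in> X \<rightarrow>\<^sub>E {0..1}" "\<forall>x\<in>X. p x + q x \<le> 1" for p q
    using EM_add[OF _ that] by (simp cong: restrict_cong)
  show "(\<lambda>k\<in>EM X. k (\<lambda>x\<in>X. r * p x)) = (\<lambda>k\<in>EM X. r * (\<lambda>k\<in>EM X. k p) k)"
    if "r \<in> {0..1}" "p \<in> X \<rightarrow>\<^sub>E {0..1}" for r p
    using EM_scale[OF _ that] by (simp cong: restrict_cong)
qed

lemma EM_map_apply: "p \<in> Y \<rightarrow>\<^sub>E {0..1} \<Longrightarrow> EM_map X Y f h p = h (compose X p f)"
  by (simp add: EM_map_def)

lemma EM_unit_apply: "p \<in> X \<rightarrow>\<^sub>E {0..1} \<Longrightarrow> EM_unit X x p = p x"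
  by (simp add: EM_unit_def)

lemma EM_mult_apply: "p \<in> X \<rightarrow>\<^sub>E {0..1} \<Longrightarrow> EM_mult X h p = h (\<lambda>k\<in>EM X. k p)"
  by (simp add: EM_mult_def)

lemma EM_map_id:
  assumes h: "h \<in> EM X"
  shows "EM_map X X (\<lambda>x. x) h = h"
proof (rule EM_ext[OF EM_map_closed[OF _ h] h])
  fix p :: "'a \<Rightarrow> real" assume p: "p \<in> X \<rightarrow>\<^sub>E {0..1}"
  then have "compose X p (\<lambda>x. x) = p" by (simp add: compose_def PiE_restrict)
  with p show "EM_map X X (\<lambda>x. x) h p = h p" by (simp add: EM_map_apply)
qed simp

lemma EM_map_compose:
  assumes f: "f \<in> X \<rightarrow> Y" and g: "g \<in> Y \<rightarrow> Z" and h: "h \<in> EM X"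
  shows "EM_map X Z (compose X g f) h = EM_map Y Z g (EM_map X Y f h)"
proof (rule EM_ext)
  fix p :: "'c \<Rightarrow> real" assume p: "p \<in> Z \<rightarrow>\<^sub>E {0..1}"
  have "compose X p (compose X g f) = compose X (compose Y p g) f"
    by (rule compose_assoc[OF f])
  with p show "EM_map X Z (compose X g f) h p = EM_map Y Z g (EM_map X Y f h) p"
    by (simp add: EM_map_apply compose_mem[OF g p])
next
  show "EM_map X Z (compose X g f) h \<in> EM Z"
    by (rule EM_map_closed[OF funcset_compose[OF f g] h])
  show "EM_map Y Z g (EM_map X Y f h) \<in> EM Z"
    by (rule EM_map_closed[OF g EM_map_closed[OF f h]])
qed

lemma EM_unit_natural:
  assumes f: "f \<in> X \<rightarrow> Y" and x: "x \<in> X"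
  shows "EM_map X Y f (EM_unit X x) = EM_unit Y (f x)"
proof (rule EM_ext)
  fix p :: "'b \<Rightarrow> real" assume p: "p \<in> Y \<rightarrow>\<^sub>E {0..1}"
  show "EM_map X Y f (EM_unit X x) p = EM_unit Y (f x) p"
    using x by (simp add: EM_map_apply[OF p] EM_unit_apply[OF p]
        EM_unit_apply[OF compose_mem[OF f p]] compose_eq)
qed (use f x in \<open>blast intro: EM_map_closed EM_unit_closed\<close>)+

lemma EM_mult_natural:
  assumes f: "f \<in> X \<rightarrow> Y" and h: "h \<in> EM (EM X)"
  shows "EM_map X Y f (EM_mult X h) = EM_mult Y (EM_map (EM X) (EM Y) (EM_map X Y f) h)"
proof (rule EM_ext)
  fix p :: "'b \<Rightarrow> real" assume p: "p \<in> Y \<rightarrow>\<^sub>E {0..1}"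
  have "compose (EM X) (\<lambda>k\<in>EM Y. k p) (EM_map X Y f) = (\<lambda>k\<in>EM X. k (compose X p f))"
    unfolding compose_def[of "EM X"]
    by (rule restrict_ext) (simp add: EM_map_closed[OF f] EM_map_apply[OF p])
  then show "EM_map X Y f (EM_mult X h) p = EM_mult Y (EM_map (EM X) (EM Y) (EM_map X Y f) h) p"
    by (simp add: EM_map_apply[OF p] EM_mult_apply[OF p] EM_mult_apply[OF compose_mem[OF f p]]
        EM_map_apply[OF eval_mem[OF p]])
qed (use f h in \<open>blast intro: EM_map_closed EM_mult_closed\<close>)+

lemma EM_mult_unit:
  assumes h: "h \<in> EM X"
  shows "EM_mult X (EM_unit (EM X) h) = h"
proof (rule EM_ext)
  fix p :: "'a \<Rightarrow> real" assume p: "p \<in> X \<rightarrow>\<^sub>E {0..1}"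
  show "EM_mult X (EM_unit (EM X) h) p = h p"
    using h by (simp add: EM_mult_apply[OF p] EM_unit_apply[OF eval_mem[OF p]])
qed (use h in \<open>blast intro: EM_mult_closed EM_unit_closed\<close>)+

lemma EM_mult_map_unit:
  assumes h: "h \<in> EM X"
  shows "EM_mult X (EM_map X (EM X) (EM_unit X) h) = h"
proof (rule EM_ext)
  fix p :: "'a \<Rightarrow> real" assume p: "p \<in> X \<rightarrow>\<^sub>E {0..1}"
  have "compose X (\<lambda>k\<in>EM X. k p) (EM_unit X) = (\<lambda>x\<in>X. p x)"
    unfolding compose_def by (rule restrict_ext) (simp add: EM_unit_closed EM_unit_apply[OF p])
  also have "\<dots> = p" by (rule PiE_restrict[OF p])
  finally show "EM_mult X (EM_map X (EM X) (EM_unit X) h) p = h p"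
    by (simp add: EM_mult_apply[OF p] EM_map_apply[OF eval_mem[OF p]])
qed (use h in \<open>blast intro: EM_mult_closed EM_unit_closed EM_map_closed\<close>)+

lemma EM_mult_assoc:
  assumes h: "h \<in> EM (EM (EM X))"
  shows "EM_mult X (EM_mult (EM X) h) = EM_mult X (EM_map (EM (EM X)) (EM X) (EM_mult X) h)"
proof (rule EM_ext)
  fix p :: "'a \<Rightarrow> real" assume p: "p \<in> X \<rightarrow>\<^sub>E {0..1}"
  have "compose (EM (EM X)) (\<lambda>k\<in>EM X. k p) (EM_mult X) = (\<lambda>H\<in>EM (EM X). H (\<lambda>k\<in>EM X. k p))"
    unfolding compose_def by (rule restrict_ext) (simp add: EM_mult_closed EM_mult_apply[OF p])
  then show "EM_mult X (EM_mult (EM X) h) p = EM_mult X (EM_map (EM (EM X)) (EM X) (EM_mult X) h) p"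
    by (simp add: EM_mult_apply[OF p] EM_mult_apply[OF eval_mem[OF p]]
        EM_map_apply[OF eval_mem[OF p]])
qed (use h in \<open>blast intro: EM_mult_closed EM_map_closed\<close>)+


section \<open>The ultrafilter monad\<close>

definition UF :: "'a set \<Rightarrow> 'a set set set" where
  "UF X = {\<F>. \<F> \<subseteq> Pow X \<and> X \<in> \<F> \<and> {} \<notin> \<F> \<and>
     (\<forall>U\<in>\<F>. \<forall>V\<in>\<F>. U \<inter> V \<in> \<F>) \<and>
     (\<forall>U\<in>\<F>. \<forall>V. U \<subseteq> V \<and> V \<subseteq> X \<longrightarrow> V \<in> \<F>) \<and>
     (\<forall>U. U \<subseteq> X \<longrightarrow> U \<in> \<F> \<or> X - U \<in> \<F>)}"

definition UF_map :: "'a set \<Rightarrow> 'b set \<Rightarrow> ('a \<Rightarrow> 'b) \<Rightarrow> 'a set set \<Rightarrow> 'b set set" where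
  "UF_map X Y f \<F> = {V. V \<subseteq> Y \<and> f -` V \<inter> X \<in> \<F>}"

definition UF_unit :: "'a set \<Rightarrow> 'a \<Rightarrow> 'a set set" where
  "UF_unit X x = {U. U \<subseteq> X \<and> x \<in> U}"

definition UF_mult :: "'a set \<Rightarrow> 'a set set set set \<Rightarrow> 'a set set" where
  "UF_mult X \<A> = {U. U \<subseteq> X \<and> {\<F> \<in> UF X. U \<in> \<F>} \<in> \<A>}"


lemma UF_D:
  assumes "\<F> \<in> UF X"
  shows "U \<in> \<F> \<Longrightarrow> U \<subseteq> X" "X \<in> \<F>" "{} \<notin> \<F>"
    "\<lbrakk>U \<in> \<F>; V \<in> \<F>\<rbrakk> \<Longrightarrow> U \<inter> V \<in> \<F>"
    "\<lbrakk>U \<in> \<F>; U \<subseteq> V; V \<subseteq> X\<rbrakk> \<Longrightarrow> V \<in> \<F>"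
    "U \<subseteq> X \<Longrightarrow> U \<in> \<F> \<or> X - U \<in> \<F>"
proof -
  note F = assms[unfolded UF_def mem_Collect_eq]
  note F2 = conjunct2[OF F] note F3 = conjunct2[OF F2] note F4 = conjunct2[OF F3]
  note F5 = conjunct2[OF F4]
  note F = conjunct1[OF F] conjunct1[OF F2] conjunct1[OF F3] conjunct1[OF F4]
    conjunct1[OF F5] conjunct2[OF F5]
  show "U \<in> \<F> \<Longrightarrow> U \<subseteq> X" using F(1) by blast
  show "X \<in> \<F>" "{} \<notin> \<F>" by (fact F)+
  show "U \<inter> V \<in> \<F>" if "U \<in> \<F>" "V \<in> \<F>" using F(4) that by simp
  show "V \<in> \<F>" if "U \<in> \<F>" "U \<subseteq> V" "V \<subseteq> X" using bspec[OF F(5) that(1)] that(2,3) by simp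
  show "U \<in> \<F> \<or> X - U \<in> \<F>" if "U \<subseteq> X" using F(6) that by simp
qed

lemma UF_compl:
  assumes F: "\<F> \<in> UF X" and U: "U \<subseteq> X"
  shows "X - U \<in> \<F> \<longleftrightarrow> U \<notin> \<F>"
proof
  assume "X - U \<in> \<F>"
  then show "U \<notin> \<F>" using UF_D(4)[OF F, of U "X - U"] UF_D(3)[OF F] by auto
next
  assume "U \<notin> \<F>"
  then show "X - U \<in> \<F>" using UF_D(6)[OF F U] by simp
qed

lemma UF_I:
  assumes "\<And>U. U \<in> \<F> \<Longrightarrow> U \<subseteq> X" "X \<in> \<F>" "{} \<notin> \<F>"
    "\<And>U V. \<lbrakk>U \<in> \<F>; V \<in> \<F>\<rbrakk> \<Longrightarrow> U \<inter> V \<in> \<F>"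
    "\<And>U V. \<lbrakk>U \<in> \<F>; U \<subseteq> V; V \<subseteq> X\<rbrakk> \<Longrightarrow> V \<in> \<F>"
    "\<And>U. U \<subseteq> X \<Longrightarrow> U \<in> \<F> \<or> X - U \<in> \<F>"
  shows "\<F> \<in> UF X"
  unfolding UF_def mem_Collect_eq
proof (intro conjI ballI allI impI)
  show "\<F> \<subseteq> Pow X" by (rule subsetI, rule PowI, rule assms(1))
  show "V \<in> \<F>" if "U \<in> \<F>" "U \<subseteq> V \<and> V \<subseteq> X" for U V
    using assms(5)[OF that(1)] that(2) by simp
qed (fact assms)+

lemma UF_map_iff: "V \<in> UF_map X Y f \<F> \<longleftrightarrow> V \<subseteq> Y \<and> f -` V \<inter> X \<in> \<F>"
  by (simp add: UF_map_def)

lemma UF_unit_iff: "U \<in> UF_unit X x \<longleftrightarrow> U \<subseteq> X \<and> x \<in> U"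
  by (simp add: UF_unit_def)

lemma UF_mult_iff: "U \<in> UF_mult X \<A> \<longleftrightarrow> U \<subseteq> X \<and> {\<F> \<in> UF X. U \<in> \<F>} \<in> \<A>"
  by (simp add: UF_mult_def)

lemma UF_map_closed:
  assumes f: "f \<in> X \<rightarrow> Y" and F: "\<F> \<in> UF X"
  shows "UF_map X Y f \<F> \<in> UF Y"
proof (rule UF_I)
  have "f -` Y \<inter> X = X" using f by blast
  then show "Y \<in> UF_map X Y f \<F>" using UF_D(2)[OF F] by (simp add: UF_map_iff)
  show "{} \<notin> UF_map X Y f \<F>" using UF_D(3)[OF F] by (simp add: UF_map_iff)
  show "U \<inter> V \<in> UF_map X Y f \<F>" if "U \<in> UF_map X Y f \<F>" "V \<in> UF_map X Y f \<F>" for U V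
  proof -
    have "f -` (U \<inter> V) \<inter> X = (f -` U \<inter> X) \<inter> (f -` V \<inter> X)" by blast
    then show ?thesis using that UF_D(4)[OF F, of "f -` U \<inter> X" "f -` V \<inter> X"]
      unfolding UF_map_iff by auto
  qed
  show "V \<in> UF_map X Y f \<F>" if "U \<in> UF_map X Y f \<F>" "U \<subseteq> V" "V \<subseteq> Y" for U V
  proof -
    have "f -` U \<inter> X \<subseteq> f -` V \<inter> X" using that(2) by blast
    then show ?thesis using that UF_D(5)[OF F, of "f -` U \<inter> X" "f -` V \<inter> X"]
      unfolding UF_map_iff by auto
  qed
  show "U \<in> UF_map X Y f \<F> \<or> Y - U \<in> UF_map X Y f \<F>" if "U \<subseteq> Y" for U
  proof -
    have "f -` (Y - U) \<inter> X = X - (f -` U \<inter> X)" using f by blast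
    then show ?thesis using that UF_D(6)[OF F, of "f -` U \<inter> X"] unfolding UF_map_iff by auto
  qed
qed (simp add: UF_map_iff)

lemma UF_unit_closed: "x \<in> X \<Longrightarrow> UF_unit X x \<in> UF X"
  by (rule UF_I) (auto simp: UF_unit_iff)

lemma UF_mult_closed:
  assumes A: "\<A> \<in> UF (UF X)"
  shows "UF_mult X \<A> \<in> UF X"
proof (rule UF_I)
  let ?C = "\<lambda>U. {\<F> \<in> UF X. U \<in> \<F>}"
  have C: "?C X = UF X" "?C {} = {}" using UF_D(2,3) by blast+
  show "X \<in> UF_mult X \<A>" unfolding UF_mult_iff C using UF_D(2)[OF A] by simp
  show "{} \<notin> UF_mult X \<A>" unfolding UF_mult_iff C using UF_D(3)[OF A] by simp
  show "U \<inter> V \<in> UF_mult X \<A>" if "U \<in> UF_mult X \<A>" "V \<in> UF_mult X \<A>" for U V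
  proof -
    have "U \<inter> V \<in> \<F> \<longleftrightarrow> U \<in> \<F> \<and> V \<in> \<F>" if "\<F> \<in> UF X" for \<F>
      using UF_D(4,5)[OF that] \<open>U \<in> UF_mult X \<A>\<close> \<open>V \<in> UF_mult X \<A>\<close>
      unfolding UF_mult_iff by (meson inf_le1 inf_le2)
    then have "?C (U \<inter> V) = ?C U \<inter> ?C V" by blast
    then show ?thesis using that UF_D(4)[OF A, of "?C U" "?C V"] unfolding UF_mult_iff by auto
  qed
  show "V \<in> UF_mult X \<A>" if "U \<in> UF_mult X \<A>" "U \<subseteq> V" "V \<subseteq> X" for U V
  proof -
    have "?C U \<subseteq> ?C V" using UF_D(5) that(2,3) by blast
    then show ?thesis using that UF_D(5)[OF A, of "?C U" "?C V"] unfolding UF_mult_iff by auto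
  qed
  show "U \<in> UF_mult X \<A> \<or> X - U \<in> UF_mult X \<A>" if "U \<subseteq> X" for U
  proof -
    have "?C (X - U) = UF X - ?C U" using UF_compl that by blast
    then show ?thesis using that UF_D(6)[OF A, of "?C U"] unfolding UF_mult_iff by auto
  qed
qed (simp add: UF_mult_iff)

lemma UF_map_id:
  assumes "\<F> \<in> UF X"
  shows "UF_map X X (\<lambda>x. x) \<F> = \<F>"
proof (rule set_eqI)
  fix U
  have "U \<inter> X = U" if "U \<subseteq> X" using that by blast
  then show "U \<in> UF_map X X (\<lambda>x. x) \<F> \<longleftrightarrow> U \<in> \<F>"
    unfolding UF_map_iff vimage_ident using UF_D(1)[OF assms, of U] by metis
qed

lemma UF_map_compose:
  assumes f: "f \<in> X \<rightarrow> Y"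
  shows "UF_map X Z (compose X g f) \<F> = UF_map Y Z g (UF_map X Y f \<F>)"
proof (rule set_eqI)
  fix V
  have "compose X g f -` V \<inter> X = f -` (g -` V \<inter> Y) \<inter> X"
    using f by (auto simp: compose_eq)
  then show "V \<in> UF_map X Z (compose X g f) \<F> \<longleftrightarrow> V \<in> UF_map Y Z g (UF_map X Y f \<F>)"
    by (simp add: UF_map_iff)
qed

lemma UF_unit_natural:
  assumes "x \<in> X"
  shows "UF_map X Y f (UF_unit X x) = UF_unit Y (f x)"
  using assms by (intro set_eqI) (simp add: UF_map_iff UF_unit_iff)

lemma UF_mult_natural:
  assumes f: "f \<in> X \<rightarrow> Y"
  shows "UF_map X Y f (UF_mult X \<A>) = UF_mult Y (UF_map (UF X) (UF Y) (UF_map X Y f) \<A>)"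
proof (rule set_eqI)
  fix V
  have "UF_map X Y f -` {\<F> \<in> UF Y. V \<in> \<F>} \<inter> UF X = {\<F> \<in> UF X. f -` V \<inter> X \<in> \<F>}" if "V \<subseteq> Y"
    using that UF_map_closed[OF f] by (auto simp: UF_map_iff)
  then show "V \<in> UF_map X Y f (UF_mult X \<A>) \<longleftrightarrow>
      V \<in> UF_mult Y (UF_map (UF X) (UF Y) (UF_map X Y f) \<A>)"
    by (auto simp: UF_map_iff[of _ _ _ _ "UF_mult X \<A>"] UF_map_iff[of _ _ _ _ \<A>] UF_mult_iff)
qed

lemma UF_mult_unit:
  assumes F: "\<F> \<in> UF X"
  shows "UF_mult X (UF_unit (UF X) \<F>) = \<F>"
proof (rule set_eqI)
  show "U \<in> UF_mult X (UF_unit (UF X) \<F>) \<longleftrightarrow> U \<in> \<F>" for U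
    using F UF_D(1)[OF F, of U] by (auto simp: UF_mult_iff UF_unit_iff)
qed

lemma UF_mult_map_unit:
  assumes F: "\<F> \<in> UF X"
  shows "UF_mult X (UF_map X (UF X) (UF_unit X) \<F>) = \<F>"
proof (rule set_eqI)
  fix U
  have "UF_unit X -` {\<G> \<in> UF X. U \<in> \<G>} \<inter> X = U" if "U \<subseteq> X"
    using that by (auto simp: UF_unit_iff intro!: UF_unit_closed)
  then show "U \<in> UF_mult X (UF_map X (UF X) (UF_unit X) \<F>) \<longleftrightarrow> U \<in> \<F>"
    using UF_D(1)[OF F, of U] by (auto simp: UF_mult_iff UF_map_iff)
qed

lemma UF_mult_assoc:
  "UF_mult X (UF_mult (UF X) \<A>) = UF_mult X (UF_map (UF (UF X)) (UF X) (UF_mult X) \<A>)"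
proof (rule set_eqI)
  fix U
  have "UF_mult X -` {\<F> \<in> UF X. U \<in> \<F>} \<inter> UF (UF X) = {\<B> \<in> UF (UF X). {\<F> \<in> UF X. U \<in> \<F>} \<in> \<B>}"
    if "U \<subseteq> X"
    using that UF_mult_closed by (auto simp: UF_mult_iff)
  then show "U \<in> UF_mult X (UF_mult (UF X) \<A>) \<longleftrightarrow>
      U \<in> UF_mult X (UF_map (UF (UF X)) (UF X) (UF_mult X) \<A>)"
    by (auto simp: UF_mult_iff[of _ X] UF_mult_iff[of _ "UF X"] UF_map_iff)
qed


section \<open>The limit map and the transformation\<close>

definition uf_limit :: "'a topology \<Rightarrow> 'a set set \<Rightarrow> 'a \<Rightarrow> bool" where
  "uf_limit T \<F> l \<longleftrightarrow> l \<in> topspace T \<and> (\<forall>U. openin T U \<and> l \<in> U \<longrightarrow> U \<in> \<F>)"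

lemma UF_limit_unique:
  assumes F: "F \<in> UF {0..1::real}"
  shows "\<exists>!l. uf_limit (top_of_set {0..1}) F l"
proof -
  let ?I = "{0..1::real}"
  note F' = UF_D(2-)[OF F]
  have fin: "\<Inter>\<C> \<in> F" if "finite \<C>" "\<C> \<noteq> {}" "\<C> \<subseteq> F" for \<C>
    using that by (induction rule: finite_ne_induct) (auto intro: F'(3))
  let ?K = "{C \<in> F. closed C}"
  have "?I \<inter> \<Inter>?K \<noteq> {}"
  proof (rule compact_imp_fip)
    show "compact ?I" by simp
    show "closed T" if "T \<in> ?K" for T using that by simp
    show "?I \<inter> \<Inter>\<C> \<noteq> {}" if "finite \<C>" "\<C> \<subseteq> ?K" for \<C>
    proof -
      have "\<Inter>(insert ?I \<C>) \<in> F"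
        using that F'(1) by (intro fin) blast+
      then show ?thesis using F'(2) by (metis Inter_insert)
    qed
  qed
  then obtain l where l: "l \<in> ?I" "\<And>C. C \<in> F \<Longrightarrow> closed C \<Longrightarrow> l \<in> C" by blast
  have "uf_limit (top_of_set ?I) F l" unfolding uf_limit_def
  proof (intro conjI allI impI)
    fix U
    assume U: "openin (top_of_set ?I) U \<and> l \<in> U"
    then obtain V where "open V" "U = ?I \<inter> V" by (auto simp: openin_open)
    then have "closed (?I - U)" "U \<subseteq> ?I" by (auto simp: Diff_Int)
    then show "U \<in> F" using F'(5)[of U] l(2)[of "?I - U"] U by blast
  qed (use l in simp)
  moreover have "a = b" if a: "uf_limit (top_of_set ?I) F a" and b: "uf_limit (top_of_set ?I) F b" for a b
  proof (rule ccontr)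
    assume "a \<noteq> b"
    then obtain U V where UV: "open U" "open V" "a \<in> U" "b \<in> V" "U \<inter> V = {}"
      using hausdorff[OF \<open>a \<noteq> b\<close>] by blast
    have "a \<in> ?I \<inter> U" "b \<in> ?I \<inter> V"
      using a b UV(3,4) unfolding uf_limit_def topspace_euclidean_subtopology by blast+
    then have "?I \<inter> U \<in> F" "?I \<inter> V \<in> F"
      using a b openin_open_Int[OF UV(1)] openin_open_Int[OF UV(2)] unfolding uf_limit_def by blast+
    then have "(?I \<inter> U) \<inter> (?I \<inter> V) \<in> F" by (rule F'(3))
    moreover have "(?I \<inter> U) \<inter> (?I \<inter> V) = {}" using UV(5) by blast
    ultimately show False using F'(2) by simp
  qed
  ultimately show ?thesis by blast
qed

definition ch :: "real set set \<Rightarrow> real" where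
  "ch \<F> = (THE l. uf_limit (top_of_set {0..1}) \<F> l)"

definition \<tau> :: "'a set \<Rightarrow> 'a set set \<Rightarrow> (('a \<Rightarrow> real) \<Rightarrow> real)" where
  "\<tau> X \<F> = (\<lambda>p \<in> X \<rightarrow>\<^sub>E {0..1}. ch (UF_map X {0..1} p \<F>))"

end

theory Submission
  imports Defs
begin

text \<open>
  The number \<open>\<tau> X \<F> p\<close> is the only \<open>l\<close> such that \<open>p\<close> is \<open>\<epsilon>\<close>-close to \<open>l\<close> on a set of \<open>\<F>\<close>, for
  every \<open>\<epsilon> > 0\<close>. Through this characterisation, preservation of the effect module structure is the
  calculus of limits. Compatibility with the multiplications is an \<open>\<epsilon>/2\<close> argument: if \<open>\<A>\<close>-most \<open>\<F>\<close>
  have \<open>\<tau> X \<F> p\<close> close to \<open>l\<close>, then for \<open>\<A>\<close>-most \<open>\<F>\<close>, \<open>\<F>\<close>-most \<open>x\<close> have \<open>p x\<close> close to \<open>l\<close>.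
\<close>

lemma \<tau>_apply: "p \<in> X \<rightarrow>\<^sub>E {0..1} \<Longrightarrow> \<tau> X \<F> p = ch (UF_map X {0..1} p \<F>)"
  by (simp add: \<tau>_def)

text \<open>The definite description in \<open>ch\<close> denotes, since an ultrafilter on the
  compact Hausdorff space \<open>{0..1}\<close> has exactly one limit.\<close>

lemma ch_limit: "F \<in> UF {0..1} \<Longrightarrow> uf_limit (top_of_set {0..1}) F (ch F)"
  unfolding ch_def by (rule theI') (rule UF_limit_unique)

lemma \<tau>_limit:
  assumes F: "\<F> \<in> UF X" and p: "p \<in> X \<rightarrow>\<^sub>E {0..1}"
  shows "uf_limit (top_of_set {0..1}) (UF_map X {0..1} p \<F>) (\<tau> X \<F> p)"
  unfolding \<tau>_apply[OF p] using p by (intro ch_limit UF_map_closed[OF _ F]) auto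

lemma \<tau>_mem:
  assumes "\<F> \<in> UF X" "p \<in> X \<rightarrow>\<^sub>E {0..1}"
  shows "\<tau> X \<F> p \<in> {0..1}"
  using \<tau>_limit[OF assms] by (simp add: uf_limit_def)

text \<open>The ball of radius \<open>e\<close> around the limit, cut down to \<open>{0..1}\<close>,
  is a relatively open neighbourhood, so its preimage under \<open>p\<close> lies in the
  ultrafilter.\<close>

lemma \<tau>_near:
  assumes F: "\<F> \<in> UF X" and p: "p \<in> X \<rightarrow>\<^sub>E {0..1}" and e: "0 < e"
  shows "{x \<in> X. \<bar>p x - \<tau> X \<F> p\<bar> < e} \<in> \<F>"
proof -
  let ?l = "\<tau> X \<F> p" and ?U = "{0..1} \<inter> ball (\<tau> X \<F> p) e"
  have "openin (top_of_set {0..1}) ?U" by (simp add: openin_open_Int)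
  moreover have "?l \<in> ?U" using \<tau>_mem[OF F p] e by simp
  ultimately have "?U \<in> UF_map X {0..1} p \<F>"
    using \<tau>_limit[OF F p] unfolding uf_limit_def by blast
  moreover have "p -` ?U \<inter> X = {x \<in> X. \<bar>p x - ?l\<bar> < e}"
    using PiE_mem[OF p] by (auto simp: dist_real_def abs_minus_commute)
  ultimately show ?thesis by (simp add: UF_map_iff)
qed

lemma \<tau>_eqI:
  assumes F: "\<F> \<in> UF X" and p: "p \<in> X \<rightarrow>\<^sub>E {0..1}"
    and near: "\<And>e. 0 < e \<Longrightarrow> {x \<in> X. \<bar>p x - l\<bar> < e} \<in> \<F>"
  shows "\<tau> X \<F> p = l"
proof (rule ccontr)
  assume "\<tau> X \<F> p \<noteq> l"
  \<comment> \<open>Half the distance between the two candidate limits makes their neighbourhoods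
    disjoint, so the ultrafilter would contain the empty set.\<close>
  define e where "e = \<bar>\<tau> X \<F> p - l\<bar> / 2"
  have e: "0 < e" using \<open>\<tau> X \<F> p \<noteq> l\<close> by (simp add: e_def)
  have "{x \<in> X. \<bar>p x - \<tau> X \<F> p\<bar> < e} \<inter> {x \<in> X. \<bar>p x - l\<bar> < e} \<in> \<F>"
    by (rule UF_D(4)[OF F \<tau>_near[OF F p e] near[OF e]])
  moreover have "{x \<in> X. \<bar>p x - \<tau> X \<F> p\<bar> < e} \<inter> {x \<in> X. \<bar>p x - l\<bar> < e} = {}"
    unfolding e_def by (auto simp: abs_if field_simps split: if_splits)
  ultimately show False using UF_D(3)[OF F] by simp
qed

lemma \<tau>_one:
  assumes F: "\<F> \<in> UF X"
  shows "\<tau> X \<F> (\<lambda>x\<in>X. 1) = 1"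
proof (rule \<tau>_eqI[OF F unit_power_mem(1)])
  fix e :: real assume "0 < e"
  then have "{x \<in> X. \<bar>(\<lambda>x\<in>X. 1) x - 1\<bar> < e} = X" by auto
  then show "{x \<in> X. \<bar>(\<lambda>x\<in>X. 1) x - 1\<bar> < e} \<in> \<F>" using UF_D(2)[OF F] by simp
qed

lemma \<tau>_add:
  assumes F: "\<F> \<in> UF X" and p: "p \<in> X \<rightarrow>\<^sub>E {0..1}" and q: "q \<in> X \<rightarrow>\<^sub>E {0..1}"
    and le: "\<forall>x\<in>X. p x + q x \<le> 1"
  shows "\<tau> X \<F> (\<lambda>x\<in>X. p x + q x) = \<tau> X \<F> p + \<tau> X \<F> q"
proof (rule \<tau>_eqI[OF F unit_power_mem(2)[OF p q le]])
  fix e :: real assume e: "0 < e"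
  let ?A = "\<lambda>p. {x \<in> X. \<bar>p x - \<tau> X \<F> p\<bar> < e / 2}"
  have "?A p \<inter> ?A q \<in> \<F>"
    using e by (intro UF_D(4)[OF F] \<tau>_near[OF F p] \<tau>_near[OF F q]) simp_all
  then show "{x \<in> X. \<bar>(\<lambda>x\<in>X. p x + q x) x - (\<tau> X \<F> p + \<tau> X \<F> q)\<bar> < e} \<in> \<F>"
    by (rule UF_D(5)[OF F]) (auto simp: abs_if split: if_splits)
qed

text \<open>Multiplication by \<open>r\<close> in \<open>{0..1}\<close> does not increase distances,
  so the set that works for \<open>p\<close> and \<open>e\<close> works for the multiple as
  well.\<close>

lemma \<tau>_scale:
  assumes F: "\<F> \<in> UF X" and r: "r \<in> {0..1}" and p: "p \<in> X \<rightarrow>\<^sub>E {0..1}"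
  shows "\<tau> X \<F> (\<lambda>x\<in>X. r * p x) = r * \<tau> X \<F> p"
proof (rule \<tau>_eqI[OF F unit_power_mem(3)[OF r p]])
  fix e :: real assume e: "0 < e"
  have "\<bar>r * p x - r * \<tau> X \<F> p\<bar> < e" if "\<bar>p x - \<tau> X \<F> p\<bar> < e" for x
  proof -
    have "\<bar>r * p x - r * \<tau> X \<F> p\<bar> = r * \<bar>p x - \<tau> X \<F> p\<bar>"
      using r by (simp add: abs_mult flip: right_diff_distrib)
    also have "\<dots> \<le> \<bar>p x - \<tau> X \<F> p\<bar>" using r by (simp add: mult_left_le_one_le)
    finally show ?thesis using that by simp
  qed
  then show "{x \<in> X. \<bar>(\<lambda>x\<in>X. r * p x) x - r * \<tau> X \<F> p\<bar> < e} \<in> \<F>"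
    by (intro UF_D(5)[OF F \<tau>_near[OF F p e]]) auto
qed

lemma \<tau>_closed:
  assumes F: "\<F> \<in> UF X"
  shows "\<tau> X \<F> \<in> EM X"
proof (rule EM_I)
  show "\<tau> X \<F> \<in> extensional (X \<rightarrow>\<^sub>E {0..1})" by (simp add: \<tau>_def)
  fix p q :: "'a \<Rightarrow> real"
  assume pq: "p \<in> X \<rightarrow>\<^sub>E {0..1}" "q \<in> X \<rightarrow>\<^sub>E {0..1}" "\<forall>x\<in>X. p x + q x \<le> 1"
  show "\<tau> X \<F> p + \<tau> X \<F> q \<le> 1 \<and> \<tau> X \<F> (\<lambda>x\<in>X. p x + q x) = \<tau> X \<F> p + \<tau> X \<F> q"
    \<comment> \<open>The bound on the sum of the two values comes for free: that sum is itself a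
      value of \<open>\<tau> X \<F>\<close>, hence at most 1.\<close>
    using \<tau>_add[OF F pq] \<tau>_mem[OF F unit_power_mem(2)[OF pq]] by simp
qed (use F in \<open>blast intro: \<tau>_mem \<tau>_one \<tau>_scale\<close>)+

lemma \<tau>_Inf:
  assumes F: "\<F> \<in> UF X" and p: "p \<in> X \<rightarrow>\<^sub>E {0..1}"
  shows "\<tau> X \<F> p = Inf {s \<in> {0..1}. {x \<in> X. p x \<le> s} \<in> \<F>}"
proof -
  let ?l = "\<tau> X \<F> p" and ?S = "{s \<in> {0..1}. {x \<in> X. p x \<le> s} \<in> \<F>}"
  have p1: "p x \<le> 1" if "x \<in> X" for x using PiE_mem[OF p that] by simp
  \<comment> \<open>Truncation at 1 keeps the bound inside \<open>{0..1}\<close> and loses no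
    points, because \<open>p\<close> never exceeds 1.\<close>
  have upper: "min 1 (?l + e) \<in> ?S" if e: "0 < e" for e
  proof -
    have "{x \<in> X. p x \<le> min 1 (?l + e)} \<in> \<F>"
      using p1 by (intro UF_D(5)[OF F \<tau>_near[OF F p e]]) auto
    then show ?thesis using e \<tau>_mem[OF F p] by simp
  qed
  have lower: "?l \<le> s" if s: "s \<in> ?S" for s
  proof (rule ccontr)
    assume "\<not> ?l \<le> s"
    \<comment> \<open>The radius \<open>?l - s\<close> forces \<open>p x > s\<close> on this set, so
      it cannot meet the sublevel set of \<open>s\<close>.\<close>
    then have "{x \<in> X. \<bar>p x - ?l\<bar> < ?l - s} \<in> \<F>" by (intro \<tau>_near[OF F p]) simp
    then have "{x \<in> X. \<bar>p x - ?l\<bar> < ?l - s} \<inter> {x \<in> X. p x \<le> s} \<in> \<F>"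
      using s UF_D(4)[OF F] by blast
    moreover have "{x \<in> X. \<bar>p x - ?l\<bar> < ?l - s} \<inter> {x \<in> X. p x \<le> s} = {}" by auto
    ultimately show False using UF_D(3)[OF F] by simp
  qed
  have "Inf ?S = ?l"
  proof (rule cInf_eq_non_empty)
    show "?S \<noteq> {}" using upper[OF zero_less_one] by blast
    fix y assume y: "\<And>s. s \<in> ?S \<Longrightarrow> y \<le> s"
    have "y \<le> ?l + e" if "0 < e" for e using y[OF upper[OF that]] by simp
    then show "y \<le> ?l" by (rule field_le_epsilon)
  qed (fact lower)
  then show ?thesis by simp
qed

text \<open>No limit argument is needed: by functoriality of \<open>UF_map\<close>, both sides at
  \<open>p\<close> are \<open>ch\<close> of the same ultrafilter on \<open>{0..1}\<close>.\<close>

lemma \<tau>_natural: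
  assumes f: "f \<in> X \<rightarrow> Y" and F: "\<F> \<in> UF X"
  shows "\<tau> Y (UF_map X Y f \<F>) = EM_map X Y f (\<tau> X \<F>)"
proof (rule EM_ext)
  fix p :: "'b \<Rightarrow> real" assume p: "p \<in> Y \<rightarrow>\<^sub>E {0..1}"
  show "\<tau> Y (UF_map X Y f \<F>) p = EM_map X Y f (\<tau> X \<F>) p"
    by (simp only: EM_map_apply[OF p] \<tau>_apply[OF p] \<tau>_apply[OF compose_mem[OF f p]]
        UF_map_compose[OF f])
qed (intro \<tau>_closed EM_map_closed UF_map_closed f F)+

lemma \<tau>_unit:
  assumes x: "x \<in> X"
  shows "\<tau> X (UF_unit X x) = EM_unit X x"
proof (rule EM_ext)
  fix p :: "'a \<Rightarrow> real" assume p: "p \<in> X \<rightarrow>\<^sub>E {0..1}"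
  show "\<tau> X (UF_unit X x) p = EM_unit X x p"
    unfolding EM_unit_apply[OF p]
    \<comment> \<open>Each neighbourhood set contains \<open>x\<close> itself, at distance 0 from
      the claimed limit \<open>p x\<close>.\<close>
    by (rule \<tau>_eqI[OF UF_unit_closed[OF x] p]) (auto simp: UF_unit_iff x)
qed (intro \<tau>_closed EM_unit_closed UF_unit_closed x)+

text \<open>This is the analytic core of the multiplication law: an iterated limit, first along each
  \<open>\<F>\<close> and then along \<open>\<A>\<close>, is one limit along
  \<open>UF_mult X \<A>\<close>.\<close>

lemma \<tau>_mult_apply:
  assumes A: "\<A> \<in> UF (UF X)" and p: "p \<in> X \<rightarrow>\<^sub>E {0..1}"
  shows "\<tau> X (UF_mult X \<A>) p = \<tau> (UF X) \<A> (\<lambda>\<F>\<in>UF X. \<tau> X \<F> p)"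
proof (rule \<tau>_eqI[OF UF_mult_closed[OF A] p])
  let ?q = "\<lambda>\<F>\<in>UF X. \<tau> X \<F> p"
  let ?l = "\<tau> (UF X) \<A> ?q"
  have q: "?q \<in> UF X \<rightarrow>\<^sub>E {0..1}"
    unfolding restrict_PiE_iff by (intro ballI \<tau>_mem p)
  fix e :: real assume e: "0 < e"
  let ?V = "{x \<in> X. \<bar>p x - ?l\<bar> < e}"
  have "?V \<in> \<F>" if F: "\<F> \<in> UF X" and close: "\<bar>\<tau> X \<F> p - ?l\<bar> < e / 2" for \<F>
  proof (rule UF_D(5)[OF F])
    show "{x \<in> X. \<bar>p x - \<tau> X \<F> p\<bar> < e / 2} \<in> \<F>" using e by (intro \<tau>_near[OF F p]) simp
    show "{x \<in> X. \<bar>p x - \<tau> X \<F> p\<bar> < e / 2} \<subseteq> ?V" using close by (auto simp: abs_if split: if_splits)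
  qed auto
  then have sub: "{\<F> \<in> UF X. \<bar>?q \<F> - ?l\<bar> < e / 2} \<subseteq> {\<F> \<in> UF X. ?V \<in> \<F>}" by auto
  have "{\<F> \<in> UF X. \<bar>?q \<F> - ?l\<bar> < e / 2} \<in> \<A>" using e by (intro \<tau>_near[OF A q]) simp
  then have "{\<F> \<in> UF X. ?V \<in> \<F>} \<in> \<A>" by (rule UF_D(5)[OF A _ sub]) auto
  then show "?V \<in> UF_mult X \<A>" unfolding UF_mult_iff by auto
qed

lemma \<tau>_mult:
  assumes A: "\<A> \<in> UF (UF X)"
  shows "\<tau> X (UF_mult X \<A>) = EM_mult X (EM_map (UF X) (EM X) (\<tau> X) (\<tau> (UF X) \<A>))"
proof (rule EM_ext)
  fix p :: "'a \<Rightarrow> real" assume p: "p \<in> X \<rightarrow>\<^sub>E {0..1}"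
  \<comment> \<open>Evaluation at \<open>p\<close> pulled back along \<open>\<tau> X\<close> is
    exactly the function whose limit along \<open>\<A>\<close> was computed above.\<close>
  have "compose (UF X) (\<lambda>k\<in>EM X. k p) (\<tau> X) = (\<lambda>\<F>\<in>UF X. \<tau> X \<F> p)"
    unfolding compose_def by (rule restrict_ext) (simp add: \<tau>_closed)
  then show "\<tau> X (UF_mult X \<A>) p = EM_mult X (EM_map (UF X) (EM X) (\<tau> X) (\<tau> (UF X) \<A>)) p"
    by (simp add: EM_mult_apply[OF p] EM_map_apply[OF eval_mem[OF p]] \<tau>_mult_apply[OF A p])
qed (intro \<tau>_closed EM_mult_closed EM_map_closed UF_mult_closed A funcsetI; assumption)+

theorem proposition16:
  fixes X :: "'a set" and Y :: "'b set"
  shows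
    "\<tau> X \<in> UF X \<rightarrow> EM X \<and>
     (\<forall>\<F>\<in>UF X. \<forall>p\<in>X \<rightarrow>\<^sub>E {0..1}.
        \<tau> X \<F> p = ch (UF_map X {0..1} p \<F>) \<and>
        ch (UF_map X {0..1} p \<F>) = Inf {s \<in> {0..1}. {x \<in> X. p x \<le> s} \<in> \<F>}) \<and>
     (\<forall>f\<in>X \<rightarrow> Y. \<forall>\<F>\<in>UF X. \<tau> Y (UF_map X Y f \<F>) = EM_map X Y f (\<tau> X \<F>)) \<and>
     (\<forall>x\<in>X. \<tau> X (UF_unit X x) = EM_unit X x) \<and>
     (\<forall>\<A>\<in>UF (UF X).
        \<tau> X (UF_mult X \<A>) = EM_mult X (EM_map (UF X) (EM X) (\<tau> X) (\<tau> (UF X) \<A>)) \<and>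
        \<tau> X (UF_mult X \<A>) = EM_mult X (\<tau> (EM X) (UF_map (UF X) (EM X) (\<tau> X) \<A>)))"
proof (intro conjI ballI)
  show "\<tau> X \<in> UF X \<rightarrow> EM X" by (intro funcsetI \<tau>_closed)
  fix \<F> assume F: "\<F> \<in> UF X"
  show "\<tau> Y (UF_map X Y f \<F>) = EM_map X Y f (\<tau> X \<F>)" if "f \<in> X \<rightarrow> Y" for f
    using that F by (rule \<tau>_natural)
  fix p :: "'a \<Rightarrow> real" assume p: "p \<in> X \<rightarrow>\<^sub>E {0..1}"
  show "\<tau> X \<F> p = ch (UF_map X {0..1} p \<F>)" by (rule \<tau>_apply[OF p])
  then show "ch (UF_map X {0..1} p \<F>) = Inf {s \<in> {0..1}. {x \<in> X. p x \<le> s} \<in> \<F>}"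
    using \<tau>_Inf[OF F p] by simp
next
  show "\<tau> X (UF_unit X x) = EM_unit X x" if "x \<in> X" for x using that by (rule \<tau>_unit)
next
  fix \<A> assume A: "\<A> \<in> UF (UF X)"
  show "\<tau> X (UF_mult X \<A>) = EM_mult X (EM_map (UF X) (EM X) (\<tau> X) (\<tau> (UF X) \<A>))"
    by (rule \<tau>_mult[OF A])
  \<comment> \<open>The two ways of applying the transformation twice agree by naturality at the map
    \<open>\<tau> X\<close> from \<open>UF X\<close> to \<open>EM X\<close>.\<close>
  also have "EM_map (UF X) (EM X) (\<tau> X) (\<tau> (UF X) \<A>) = \<tau> (EM X) (UF_map (UF X) (EM X) (\<tau> X) \<A>)"
    by (rule \<tau>_natural[symmetric, OF _ A]) (intro funcsetI \<tau>_closed)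
  finally show "\<tau> X (UF_mult X \<A>) = EM_mult X (\<tau> (EM X) (UF_map (UF X) (EM X) (\<tau> X) \<A>))" .
qed

end
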